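(* Let $x,x'\in\mathbb{H}^3$ be points, let $x_0x_1$ and $x_0'x_1'$ be lines in $\mathbb{H}^3$ given by linearly independent pairs $x_0,x_1\in\mathbb{L}^3_+$ and $x'_0,x'_1\in\mathbb{L}^3_+$, and let $\perp(n)$ and $\perp(n')$ be planes in $\mathbb{H}^3$ given by $n,n'\in\mathbb{R}^{1,3}$ with $n\cdot n=n'\cdot n'=1$. Then the (unsigned) hyperbolic distances are given by: $$d(x,x')=\cosh^{-1}(-x\cdot x')=\cosh^{-1}\left(\frac{(x'-x)\cdot(x'-x)}{2}+1\right),$$ $$d(x,x_0x_1)=\cosh^{-1}\sqrt{-2\,\frac{(x_0\cdot x)(x\cdot x_1)}{x_0\cdot x_1}},$$ $$d(x_0x_1,x_0'x_1')=2\sinh^{-1}\sqrt{\frac{\lambda-1}{2}}\quad\text{where}\quad \lambda=\sqrt{\frac{(x_0\cdot x_0')(x_1\cdot x_1')}{(x_0\cdot x_1)(x_0'\cdot x_1')}}+\sqrt{\frac{(x_0\cdot x_1')(x_1\cdot x_0')}{(x_0\cdot x_1)(x_0'\cdot x_1')}},$$ $$d(x,\perp(n))=\left|\sinh^{-1}(x\cdot n)\right|,$$ $$d(x_0x_1,\perp(n))=\begin{cases}\sinh^{-1}\sqrt{-2\,\dfrac{(x_0\cdot n)(n\cdot x_1)}{x_0\cdot x_1}} & \text{if } (x_0\cdot n)(n\cdot x_1)>0,\\[2mm] 0 & \text{otherwise,}\end{cases}$$ $$d(\perp(n),\perp(n'))=\begin{cases}\cosh^{-1}|n\cdot n'| &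 \text{if } |n\cdot n'|\ge 1,\\ 0 & \text{otherwise.}\end{cases}$$
   Context: $\mathbb{R}^{1,3}$ is $\mathbb{R}^4$ with coordinates indexed $0,\dots,3$ and the inner product $x\cdot x'$ of signature $(-,+,+,+)$. The hyperboloid model is $\mathbb{H}^3=\{x\in\mathbb{R}^{1,3}: x_0>0,\ x\cdot x=-1\}$ with its standard hyperbolic metric of curvature $-1$, and $\mathbb{L}^3_+=\{x\in\mathbb{R}^{1,3}: x_0>0,\ x\cdot x=0\}$ is the future light-cone (in these two definitions $x_0$ denotes the time coordinate of $x$). For a time-like $y$ with positive time coordinate, $\widehat{y}=y/\sqrt{-y\cdot y}\in\mathbb{H}^3$. For linearly independent $x_0,x_1\in\mathbb{L}^3_+$, the line $x_0x_1$ is the geodesic $\{\widehat{(1-s)x_0+sx_1}: 0<s<1\}$. For $n$ with $n\cdot n=1$, the plane is $\perp(n)=\{x\in\mathbb{H}^3: x\cdot n=0\}$. The distance between two subsets of $\mathbb{H}^3$ is the infimum of the distances between their points. *)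

theory Defs
  imports "HOL-Analysis.Analysis"
begin

(* In the index type 4 the elements are 0, 1, 2, 3 (and 4 = 0); x $ 0 is the time coordinate. *)
definition mink :: "real ^ 4 \<Rightarrow> real ^ 4 \<Rightarrow> real"  (infixl "\<bullet>\<^sub>M" 70) where
  "x \<bullet>\<^sub>M y = - (x $ 0 * y $ 0) + x $ 1 * y $ 1 + x $ 2 * y $ 2 + x $ 3 * y $ 3"

definition hyp3 :: "(real ^ 4) set" where
  "hyp3 = {x. x $ 0 > 0 \<and> x \<bullet>\<^sub>M x = - 1}"

definition light_cone :: "(real ^ 4) set" where
  "light_cone = {x. x $ 0 > 0 \<and> x \<bullet>\<^sub>M x = 0}"

(* Meaningful for time-like y with positive time coordinate. *)
definition hyp_normalize :: "real ^ 4 \<Rightarrow> real ^ 4" where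
  "hyp_normalize y = y /\<^sub>R sqrt (- (y \<bullet>\<^sub>M y))"

definition hyp_line :: "real ^ 4 \<Rightarrow> real ^ 4 \<Rightarrow> (real ^ 4) set" where
  "hyp_line x\<^sub>0 x\<^sub>1 = {hyp_normalize ((1 - s) *\<^sub>R x\<^sub>0 + s *\<^sub>R x\<^sub>1) | s. 0 < s \<and> s < 1}"

definition hyp_plane :: "real ^ 4 \<Rightarrow> (real ^ 4) set" where
  "hyp_plane n = {x \<in> hyp3. x \<bullet>\<^sub>M n = 0}"

(* The standard metric of curvature -1 is the Riemannian metric that the Minkowski form induces
   on the tangent spaces of the hyperboloid; the distance is the infimum of the lengths of
   piecewise C1 curves.  On tangent vectors the form is positive definite, so the square root
   below is applied to nonnegative numbers wherever the curve is differentiable. *)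
definition hyp_speed :: "(real \<Rightarrow> real ^ 4) \<Rightarrow> real \<Rightarrow> real" where
  "hyp_speed g t =
     (let v = vector_derivative g (at t within {0..1}) in sqrt (v \<bullet>\<^sub>M v))"

definition hyp_length :: "(real \<Rightarrow> real ^ 4) \<Rightarrow> real" where
  "hyp_length g = integral {0..1} (hyp_speed g)"

(* valid_path allows the derivative to be unbounded near the finitely many exceptional points,
   so the speed of such a path may fail to be integrable (infinite length), in which case
   the integral operator returns 0.  Those paths have to be excluded explicitly. *)
definition hyp_curves :: "real ^ 4 \<Rightarrow> real ^ 4 \<Rightarrow> (real \<Rightarrow> real ^ 4) set" where
  "hyp_curves x y = {g. valid_path g \<and> path_image g \<subseteq> hyp3 \<and>
     pathstart g = x \<and> pathfinish g = y \<and> hyp_speed g integrable_on {0..1}}"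

definition hyp_dist :: "real ^ 4 \<Rightarrow> real ^ 4 \<Rightarrow> real" where
  "hyp_dist x y = (INF g \<in> hyp_curves x y. hyp_length g)"

definition hyp_setdist :: "(real ^ 4) set \<Rightarrow> (real ^ 4) set \<Rightarrow> real" where
  "hyp_setdist A B = Inf {hyp_dist a b | a b. a \<in> A \<and> b \<in> B}"

end

theory Submission
  imports Defs
begin

text \<open>
  All the formulas follow from one estimate. If \<open>n \<bullet>\<^sub>M n = 1\<close>, then \<open>g \<mapsto> arsinh (g \<bullet>\<^sub>M n)\<close>
  (geometrically the signed distance to the plane orthogonal to \<open>n\<close>) is 1-Lipschitz along curves
  in the hyperboloid: its derivative along a tangent vector \<open>v\<close> at \<open>g\<close> is
  \<open>(v \<bullet>\<^sub>M n) / sqrt ((g \<bullet>\<^sub>M n)\<^sup>2 + 1)\<close>, the denominator is the length of the tangential part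
  \<open>n + (g \<bullet>\<^sub>M n) g\<close> of \<open>n\<close>, and the form is positive definite on tangent spaces, so that the
  Cauchy-Schwarz inequality bounds the quotient by the speed (\<open>arsinh_mink_le_length\<close>).
  Unlike the distance from a point, this function is smooth everywhere, so no singularity has to
  be avoided when it is integrated along a curve.

  Taking for \<open>n\<close> the initial direction of the geodesic from \<open>x\<close> to \<open>y\<close>, the difference of
  the two values of the function is the length of the geodesic. This gives
  \<open>hyp_dist x y = arcosh (- (x \<bullet>\<^sub>M y))\<close> (\<open>hyp_dist_eq_arcosh\<close>).

  Distances between sets thus reduce to an infimum of \<open>- (a \<bullet>\<^sub>M b)\<close> (\<open>hyp_setdist_arcoshI\<close>),
  and distances to a plane to an infimum of \<open>\<bar>a \<bullet>\<^sub>M n\<bar>\<close>, because the foot of the perpendicular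
  from \<open>a\<close> attains the Lipschitz bound (\<open>hyp_setdist_planeI\<close>).
  The points of the line with ends \<open>a\<close> and \<open>b\<close> are
  \<open>(u a + b / u) / sqrt (- 2 (a \<bullet>\<^sub>M b))\<close> with \<open>u > 0\<close>. For the three formulas about
  lines, the quantity to minimise is therefore a combination of expressions \<open>u p + q / u\<close>, whose
  infimum is \<open>2 sqrt (p q)\<close> for \<open>p, q \<ge> 0\<close>. For two lines with parameters \<open>u\<close> and \<open>v\<close> there are two such
  expressions, in the independent variables \<open>u v\<close> and \<open>u / v\<close>, which explains the two square roots
  in the formula. The infimum need not be attained when \<open>p\<close> or \<open>q\<close> vanishes, for instance for lines
  with a common end. For two planes, only the part \<open>m = n' - (n \<bullet>\<^sub>M n') n\<close> of \<open>n'\<close> orthogonal to \<open>n\<close>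
  matters. If it is time-like, the reversed Cauchy-Schwarz inequality gives the sharp lower
  bound; otherwise \<open>y \<bullet>\<^sub>M m\<close> takes arbitrarily small values on the first plane.
\<close>

section \<open>The Minkowski form\<close>

lemma bounded_bilinear_mink: "bounded_bilinear (\<bullet>\<^sub>M)"
proof -
  have "bilinear (\<bullet>\<^sub>M)"
    unfolding bilinear_def by (auto intro!: linearI simp: mink_def algebra_simps)
  then show ?thesis
    by (simp add: bilinear_conv_bounded_bilinear)
qed

lemmas mink_simps =
  bounded_bilinear.add_left[OF bounded_bilinear_mink]
  bounded_bilinear.add_right[OF bounded_bilinear_mink]
  bounded_bilinear.diff_left[OF bounded_bilinear_mink]
  bounded_bilinear.diff_right[OF bounded_bilinear_mink]
  bounded_bilinear.minus_left[OF bounded_bilinear_mink]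
  bounded_bilinear.minus_right[OF bounded_bilinear_mink]
  bounded_bilinear.scaleR_left[OF bounded_bilinear_mink]
  bounded_bilinear.scaleR_right[OF bounded_bilinear_mink]

lemma mink_commute: "x \<bullet>\<^sub>M y = y \<bullet>\<^sub>M x"
  by (simp add: mink_def mult.commute)

lemma cauchy_schwarz_3:
  fixes a b c d e f :: real
  shows "(a * d + b * e + c * f)\<^sup>2 \<le> (a\<^sup>2 + b\<^sup>2 + c\<^sup>2) * (d\<^sup>2 + e\<^sup>2 + f\<^sup>2)"
proof -
  have "(a\<^sup>2 + b\<^sup>2 + c\<^sup>2) * (d\<^sup>2 + e\<^sup>2 + f\<^sup>2) - (a * d + b * e + c * f)\<^sup>2
      = (a * e - b * d)\<^sup>2 + (a * f - c * d)\<^sup>2 + (b * f - c * e)\<^sup>2"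
    by algebra
  then show ?thesis
    by (smt (verit) zero_le_power2)
qed

text \<open>
  If \<open>v \<bullet>\<^sub>M g = 0\<close>, the Euclidean Cauchy-Schwarz inequality for the spatial parts bounds
  \<open>(v $ 0 * g $ 0)\<^sup>2\<close> by \<open>S ((g $ 0)\<^sup>2 - 1)\<close> with \<open>S\<close> the squared spatial norm of \<open>v\<close>,
  so the time component of \<open>v\<close> cannot dominate.
\<close>
lemma tangent_nonneg:
  assumes "g \<in> hyp3" "v \<bullet>\<^sub>M g = 0"
  shows "v \<bullet>\<^sub>M v \<ge> 0"
proof -
  define S where "S = (v $ 1)\<^sup>2 + (v $ 2)\<^sup>2 + (v $ 3)\<^sup>2"
  have g: "g $ 0 > 0" "(g $ 1)\<^sup>2 + (g $ 2)\<^sup>2 + (g $ 3)\<^sup>2 = (g $ 0)\<^sup>2 - 1"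
    using assms(1) by (auto simp: hyp3_def mink_def power2_eq_square)
  have "v $ 0 * g $ 0 = v $ 1 * g $ 1 + v $ 2 * g $ 2 + v $ 3 * g $ 3"
    using assms(2) by (simp add: mink_def)
  then have "(v $ 0 * g $ 0)\<^sup>2 \<le> S * ((g $ 0)\<^sup>2 - 1)"
    using cauchy_schwarz_3[of "v $ 1" "g $ 1" "v $ 2" "g $ 2" "v $ 3" "g $ 3"] g(2)
    by (simp add: S_def)
  also have "\<dots> \<le> S * (g $ 0)\<^sup>2"
    by (simp add: S_def mult_left_mono)
  finally have "(v $ 0)\<^sup>2 \<le> S"
    using g(1) by (simp add: power_mult_distrib)
  then show ?thesis
    by (simp add: S_def mink_def power2_eq_square)
qed

text \<open>
  This is semidefiniteness for the tangential part \<open>v + (v \<bullet>\<^sub>M g) g\<close>. For time-like \<open>v\<close> it bounds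
  \<open>\<bar>v \<bullet>\<^sub>M g\<bar>\<close> from below.
\<close>
lemma reverse_cauchy_schwarz:
  assumes "g \<in> hyp3"
  shows "v \<bullet>\<^sub>M v + (v \<bullet>\<^sub>M g)\<^sup>2 \<ge> 0"
proof -
  have g: "g \<bullet>\<^sub>M g = - 1"
    using assms by (simp add: hyp3_def)
  have "(v + (v \<bullet>\<^sub>M g) *\<^sub>R g) \<bullet>\<^sub>M g = 0"
    by (simp add: mink_simps g)
  from tangent_nonneg[OF assms this] show ?thesis
    by (simp add: mink_simps g mink_commute[of g v] power2_eq_square)
qed

text \<open>
  The usual derivation from semidefiniteness, applied to the vector \<open>(w \<bullet>\<^sub>M w) v - (v \<bullet>\<^sub>M w) w\<close>.
\<close>
lemma tangent_cauchy_schwarz: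
  assumes "g \<in> hyp3" "v \<bullet>\<^sub>M g = 0" "w \<bullet>\<^sub>M g = 0" "w \<bullet>\<^sub>M w > 0"
  shows "(v \<bullet>\<^sub>M w)\<^sup>2 \<le> (v \<bullet>\<^sub>M v) * (w \<bullet>\<^sub>M w)"
proof -
  define u where "u = (w \<bullet>\<^sub>M w) *\<^sub>R v - (v \<bullet>\<^sub>M w) *\<^sub>R w"
  have "u \<bullet>\<^sub>M g = 0"
    using assms by (simp add: u_def mink_simps)
  then have "0 \<le> u \<bullet>\<^sub>M u"
    by (rule tangent_nonneg[OF assms(1)])
  also have "u \<bullet>\<^sub>M u = (w \<bullet>\<^sub>M w) * ((v \<bullet>\<^sub>M v) * (w \<bullet>\<^sub>M w) - (v \<bullet>\<^sub>M w)\<^sup>2)"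
    by (simp add: u_def mink_simps mink_commute[of w v] power2_eq_square algebra_simps)
  finally show ?thesis
    using assms(4) by (simp add: zero_le_mult_iff)
qed

lemma mink_hyp3_neg:
  assumes "x \<in> hyp3" "y \<bullet>\<^sub>M y \<le> 0" "y $ 0 > 0"
  shows "x \<bullet>\<^sub>M y < 0"
proof -
  define p where "p = x $ 1 * y $ 1 + x $ 2 * y $ 2 + x $ 3 * y $ 3"
  have x: "x $ 0 > 0" "(x $ 1)\<^sup>2 + (x $ 2)\<^sup>2 + (x $ 3)\<^sup>2 = (x $ 0)\<^sup>2 - 1"
    using assms(1) by (auto simp: hyp3_def mink_def power2_eq_square)
  have y: "(y $ 1)\<^sup>2 + (y $ 2)\<^sup>2 + (y $ 3)\<^sup>2 \<le> (y $ 0)\<^sup>2"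
    using assms(2) by (auto simp: mink_def power2_eq_square)
  have "p\<^sup>2 \<le> ((x $ 0)\<^sup>2 - 1) * ((y $ 1)\<^sup>2 + (y $ 2)\<^sup>2 + (y $ 3)\<^sup>2)"
    using cauchy_schwarz_3[of "x $ 1" "y $ 1" "x $ 2" "y $ 2" "x $ 3" "y $ 3"] x(2)
    by (simp add: p_def)
  also have "\<dots> \<le> ((x $ 0)\<^sup>2 - 1) * (y $ 0)\<^sup>2"
    using y by (intro mult_left_mono) (auto simp: x(2)[symmetric])
  also have "\<dots> < (x $ 0 * y $ 0)\<^sup>2"
    using assms(3) by (simp add: power_mult_distrib left_diff_distrib)
  finally have "p < x $ 0 * y $ 0"
    by (rule power2_less_imp_less) (use x(1) assms(3) in auto)
  then show ?thesis
    by (simp add: mink_def p_def)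
qed

lemma hyp3_mink_le:
  assumes "x \<in> hyp3" "y \<in> hyp3"
  shows "x \<bullet>\<^sub>M y \<le> - 1"
proof -
  have y: "y \<bullet>\<^sub>M y = - 1" "y $ 0 > 0"
    using assms(2) by (auto simp: hyp3_def)
  have neg: "x \<bullet>\<^sub>M y < 0"
    using y by (intro mink_hyp3_neg[OF assms(1)]) auto
  have "(y \<bullet>\<^sub>M x)\<^sup>2 \<ge> 1"
    using reverse_cauchy_schwarz[OF assms(1), of y] y by simp
  then have "1\<^sup>2 \<le> (- (x \<bullet>\<^sub>M y))\<^sup>2"
    by (simp add: mink_commute)
  then have "1 \<le> - (x \<bullet>\<^sub>M y)"
    by (rule power2_le_imp_le) (use neg in simp)
  then show ?thesis by simp
qed

text \<open>
  The hypothesis \<open>x \<bullet>\<^sub>M y < 0\<close> decides between the two sheets of the hyperboloid: it makes \<open>y\<close>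
  future-directed without computing its time component.
\<close>
lemma hyp3_normalizeI:
  assumes "x \<in> hyp3" "y \<bullet>\<^sub>M y < 0" "x \<bullet>\<^sub>M y < 0"
  shows "y /\<^sub>R sqrt (- (y \<bullet>\<^sub>M y)) \<in> hyp3"
proof -
  have "y $ 0 > 0"
  proof (rule ccontr)
    assume "\<not> y $ 0 > 0"
    moreover have "y $ 0 \<noteq> 0"
    proof
      assume "y $ 0 = 0"
      then have "y \<bullet>\<^sub>M y = (y $ 1)\<^sup>2 + (y $ 2)\<^sup>2 + (y $ 3)\<^sup>2"
        by (simp add: mink_def power2_eq_square)
      then show False
        using assms(2) by (smt (verit) zero_le_power2)
    qed
    ultimately have "(- y) $ 0 > 0" by simp
    with mink_hyp3_neg[OF assms(1), of "- y"] assms(2,3) show False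
      by (simp add: mink_simps)
  qed
  moreover have "inverse (sqrt (- (y \<bullet>\<^sub>M y))) * inverse (sqrt (- (y \<bullet>\<^sub>M y))) = - inverse (y \<bullet>\<^sub>M y)"
    using assms(2) by (simp flip: inverse_mult_distrib)
  ultimately show ?thesis
    using assms(2) by (simp add: hyp3_def mink_simps flip: mult.assoc)
qed

text \<open>
  The combination \<open>b\<^sub>0 a - a\<^sub>0 b\<close> has vanishing time component, so its square is the Euclidean one; on the
  other hand, that square is \<open>- 2 a\<^sub>0 b\<^sub>0 (a \<bullet>\<^sub>M b)\<close>, since \<open>a\<close> and \<open>b\<close> are null.
\<close>
lemma light_cone_mink:
  assumes "a \<in> light_cone" "b \<in> light_cone"
  shows "a \<bullet>\<^sub>M b \<le> 0" and "a \<bullet>\<^sub>M b = 0 \<Longrightarrow> (b $ 0) *\<^sub>R a = (a $ 0) *\<^sub>R b"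
proof -
  have *: "a $ 0 > 0" "b $ 0 > 0" "a \<bullet>\<^sub>M a = 0" "b \<bullet>\<^sub>M b = 0"
    using assms by (auto simp: light_cone_def)
  define d where "d = (b $ 0) *\<^sub>R a - (a $ 0) *\<^sub>R b"
  have d0: "d $ 0 = 0"
    by (simp add: d_def)
  have dd: "(d $ 1)\<^sup>2 + (d $ 2)\<^sup>2 + (d $ 3)\<^sup>2 = - 2 * (a $ 0 * b $ 0) * (a \<bullet>\<^sub>M b)"
  proof -
    have "d \<bullet>\<^sub>M d = - 2 * (a $ 0 * b $ 0) * (a \<bullet>\<^sub>M b)"
      by (simp add: d_def mink_simps * mink_commute[of b a])
    then show ?thesis
      by (simp add: mink_def[of d d] d0 power2_eq_square)
  qed
  then have le: "(a $ 0 * b $ 0) * (a \<bullet>\<^sub>M b) \<le> 0"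
    using zero_le_power2[of "d $ 1"] zero_le_power2[of "d $ 2"] zero_le_power2[of "d $ 3"]
    by linarith
  have "a $ 0 * b $ 0 > 0"
    using *(1,2) by simp
  with le show "a \<bullet>\<^sub>M b \<le> 0"
    by (metis mult_pos_pos not_less)
  assume "a \<bullet>\<^sub>M b = 0"
  with dd have "(d $ 1)\<^sup>2 + (d $ 2)\<^sup>2 + (d $ 3)\<^sup>2 = 0"
    by simp
  then have "d $ 1 = 0 \<and> d $ 2 = 0 \<and> d $ 3 = 0"
    using zero_le_power2[of "d $ 1"] zero_le_power2[of "d $ 2"] zero_le_power2[of "d $ 3"]
    by (simp add: add_nonneg_eq_0_iff)
  \<comment> \<open>The index \<open>4\<close> in \<open>forall_4\<close> is the time index \<open>0\<close>.\<close>
  moreover have four: "(4 :: 4) = 0"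
    by (simp flip: iszero_def)
  ultimately have "d = 0"
    using d0 unfolding vec_eq_iff forall_4 four by simp
  then show "(b $ 0) *\<^sub>R a = (a $ 0) *\<^sub>R b"
    by (simp add: d_def)
qed

lemma light_cone_mink_neg:
  assumes "a \<in> light_cone" "b \<in> light_cone" "a \<noteq> b" "independent {a, b}"
  shows "a \<bullet>\<^sub>M b < 0"
proof (rule ccontr)
  assume "\<not> ?thesis"
  then have eq: "(b $ 0) *\<^sub>R a = (a $ 0) *\<^sub>R b"
    using light_cone_mink[OF assms(1,2)] by fastforce
  have pos: "a $ 0 > 0" "b $ 0 > 0"
    using assms by (auto simp: light_cone_def)
  have "a = (a $ 0 / b $ 0) *\<^sub>R b"
    using arg_cong[OF eq, of "\<lambda>z. (1 / b $ 0) *\<^sub>R z"] pos by simp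
  then have "a \<in> span {b}"
    by (metis span_base span_scale insertI1)
  then show False
    using assms(3,4) by (simp add: independent_insert)
qed

section \<open>Curves in the hyperboloid\<close>

lemma tangent_vector:
  assumes "(g has_vector_derivative v) (at t)" "open T" "t \<in> T" "\<And>s. s \<in> T \<Longrightarrow> g s \<in> hyp3"
  shows "v \<bullet>\<^sub>M g t = 0"
proof -
  have "((\<lambda>s. g s \<bullet>\<^sub>M g s) has_vector_derivative (g t \<bullet>\<^sub>M v + v \<bullet>\<^sub>M g t)) (at t)"
    by (rule bounded_bilinear.has_vector_derivative[OF bounded_bilinear_mink assms(1,1)])
  moreover have "((\<lambda>s. g s \<bullet>\<^sub>M g s) has_vector_derivative 0) (at t)"
  proof (rule has_vector_derivative_transform_within_open[of "\<lambda>_. - 1" _ _ T])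
    show "((\<lambda>_. - 1 :: real) has_vector_derivative 0) (at t)"
      by (rule has_vector_derivative_const)
  qed (use assms in \<open>auto simp: hyp3_def\<close>)
  ultimately have "g t \<bullet>\<^sub>M v + v \<bullet>\<^sub>M g t = 0"
    by (rule vector_derivative_unique_at)
  then show ?thesis
    by (simp add: mink_commute)
qed

text \<open>
  Cauchy-Schwarz for \<open>v\<close> and the tangential part \<open>w = n + (g \<bullet>\<^sub>M n) g\<close> of \<open>n\<close>, which satisfies
  \<open>v \<bullet>\<^sub>M w = v \<bullet>\<^sub>M n\<close> and \<open>w \<bullet>\<^sub>M w = (g \<bullet>\<^sub>M n)\<^sup>2 + 1\<close>.
\<close>
lemma arsinh_mink_speed_bound:
  assumes "g \<in> hyp3" "v \<bullet>\<^sub>M g = 0" "n \<bullet>\<^sub>M n = 1"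
  shows "(v \<bullet>\<^sub>M n) / sqrt ((g \<bullet>\<^sub>M n)\<^sup>2 + 1) \<le> sqrt (v \<bullet>\<^sub>M v)"
proof -
  define w where "w = n + (g \<bullet>\<^sub>M n) *\<^sub>R g"
  have g: "g \<bullet>\<^sub>M g = - 1"
    using assms(1) by (simp add: hyp3_def)
  have wg: "w \<bullet>\<^sub>M g = 0"
    by (simp add: w_def mink_simps g mink_commute)
  have ww: "w \<bullet>\<^sub>M w = (g \<bullet>\<^sub>M n)\<^sup>2 + 1"
    by (simp add: w_def mink_simps g assms(3) mink_commute[of n g] power2_eq_square)
  have vw: "v \<bullet>\<^sub>M w = v \<bullet>\<^sub>M n"
    by (simp add: w_def mink_simps assms(2))
  have pos: "(g \<bullet>\<^sub>M n)\<^sup>2 + 1 > 0"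
    by (simp add: add_nonneg_pos)
  have "(v \<bullet>\<^sub>M n)\<^sup>2 \<le> (v \<bullet>\<^sub>M v) * ((g \<bullet>\<^sub>M n)\<^sup>2 + 1)"
    using tangent_cauchy_schwarz[OF assms(1,2) wg] pos by (simp add: ww vw)
  then have "v \<bullet>\<^sub>M n \<le> sqrt ((v \<bullet>\<^sub>M v) * ((g \<bullet>\<^sub>M n)\<^sup>2 + 1))"
    by (rule real_le_rsqrt)
  then show ?thesis
    using pos by (simp add: real_sqrt_mult pos_divide_le_eq)
qed

lemma has_integral_le_off_finite:
  fixes f g :: "real \<Rightarrow> real"
  assumes "(f has_integral a) T" "(g has_integral b) T" "finite S"
    and "\<And>t. t \<in> T - S \<Longrightarrow> f t \<le> g t"
  shows "a \<le> b"
proof (rule has_integral_le)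
  show "((\<lambda>t. if t \<in> S then g t else f t) has_integral a) T"
    by (rule has_integral_spike_finite[OF assms(3) _ assms(1)]) auto
qed (use assms in auto)

text \<open>
  The left-hand side is the integral of the derivative of \<open>arsinh (g t \<bullet>\<^sub>M n)\<close>, which is at most the
  speed except at finitely many points.
\<close>
lemma arsinh_mink_le_length:
  assumes "g \<in> hyp_curves x y" "n \<bullet>\<^sub>M n = 1"
  shows "arsinh (y \<bullet>\<^sub>M n) - arsinh (x \<bullet>\<^sub>M n) \<le> hyp_length g"
proof -
  from assms(1) have g: "g piecewise_C1_differentiable_on {0..1}" "path_image g \<subseteq> hyp3"
    "g 0 = x" "g 1 = y" "hyp_speed g integrable_on {0..1}"
    by (auto simp: hyp_curves_def valid_path_def pathstart_def pathfinish_def)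
  then obtain S where S: "finite S" "g C1_differentiable_on ({0..1} - S)"
    and cont: "continuous_on {0..1} g"
    by (auto simp: piecewise_C1_differentiable_on_def)
  have in_hyp: "g t \<in> hyp3" if "t \<in> {0..1}" for t
    using g(2) that by (auto simp: path_image_def)
  define v where "v t = vector_derivative g (at t within {0..1})" for t
  have deriv: "(g has_vector_derivative v t) (at t)" if "t \<in> {0<..<1} - S" for t
  proof -
    from S(2) that have "g differentiable (at t)"
      by (auto simp: C1_differentiable_on_eq)
    moreover from this that have "vector_derivative g (at t within {0..1}) = vector_derivative g (at t)"
      by (intro vector_derivative_at_within_ivl) (auto simp: vector_derivative_works)
    ultimately show ?thesis
      by (simp add: v_def vector_derivative_works)
  qed
  define h where "h t = (v t \<bullet>\<^sub>M n) / sqrt ((g t \<bullet>\<^sub>M n)\<^sup>2 + 1)" for t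
  have "((\<lambda>t. arsinh (g t \<bullet>\<^sub>M n)) has_vector_derivative h t) (at t)" if "t \<in> {0<..<1} - S" for t
  proof -
    have "((\<lambda>t. g t \<bullet>\<^sub>M n) has_real_derivative v t \<bullet>\<^sub>M n) (at t)"
      using bounded_linear.has_vector_derivative
        [OF bounded_bilinear.bounded_linear_left[OF bounded_bilinear_mink] deriv[OF that]]
      by (simp add: has_real_derivative_iff_has_vector_derivative)
    then have "((\<lambda>t. arsinh (g t \<bullet>\<^sub>M n)) has_real_derivative h t) (at t)"
      using DERIV_chain2[OF arsinh_real_has_field_derivative] by (fastforce simp: h_def)
    then show ?thesis
      by (simp add: has_real_derivative_iff_has_vector_derivative)
  qed
  moreover have "continuous_on {0..1} (\<lambda>t. arsinh (g t \<bullet>\<^sub>M n))"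
    by (intro continuous_intros
        bounded_linear.continuous_on[OF bounded_bilinear.bounded_linear_left[OF bounded_bilinear_mink]] cont)
  ultimately have int_h: "(h has_integral (arsinh (y \<bullet>\<^sub>M n) - arsinh (x \<bullet>\<^sub>M n))) {0..1}"
    using fundamental_theorem_of_calculus_interior_strong
      [of S 0 1 "\<lambda>t. arsinh (g t \<bullet>\<^sub>M n)" h] S(1) g(3,4)
    by auto
  have int_speed: "(hyp_speed g has_integral hyp_length g) {0..1}"
    using g(5) by (simp add: hyp_length_def integrable_integral)
  have le: "h t \<le> hyp_speed g t" if "t \<in> {0..1} - ({0, 1} \<union> S)" for t
  proof -
    have t: "t \<in> {0<..<1} - S" using that by auto
    then have "v t \<bullet>\<^sub>M g t = 0"
      by (intro tangent_vector[OF deriv, of _ "{0<..<1}"]) (auto intro: in_hyp)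
    then have "h t \<le> sqrt (v t \<bullet>\<^sub>M v t)"
      unfolding h_def using t by (intro arsinh_mink_speed_bound in_hyp assms) auto
    then show ?thesis
      by (simp add: hyp_speed_def v_def Let_def)
  qed
  show ?thesis
    by (rule has_integral_le_off_finite[where S = "{0, 1} \<union> S", OF int_h int_speed])
      (use S(1) le in auto)
qed

section \<open>Geodesics and the distance between points\<close>

text \<open>
  A curve \<open>a t x + b t y\<close> stays in the hyperboloid and has constant speed \<open>L\<close> as soon as two
  quadratic identities in \<open>a\<close>, \<open>b\<close> and their derivatives hold. The coefficients are nonnegative, so the
  time component is positive. The form of the statement covers both the geodesic
  and the degenerate case of distance zero.
\<close>
lemma hyp_curve_combination:
  fixes a b a' b' :: "real \<Rightarrow> real"
  assumes "x \<in> hyp3" "y \<in> hyp3" and L: "L \<ge> 0"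
    and da: "\<And>t. (a has_real_derivative a' t) (at t)" and db: "\<And>t. (b has_real_derivative b' t) (at t)"
    and cont: "continuous_on UNIV a'" "continuous_on UNIV b'"
    and ends: "a 0 = 1" "a 1 = 0" "b 0 = 0" "b 1 = 1"
    and nonneg: "\<And>t. t \<in> {0..1} \<Longrightarrow> a t \<ge> 0 \<and> b t \<ge> 0"
    and unit: "\<And>t. (a t)\<^sup>2 + (b t)\<^sup>2 - 2 * a t * b t * (x \<bullet>\<^sub>M y) = 1"
    and speed: "\<And>t. 2 * a' t * b' t * (x \<bullet>\<^sub>M y) - (a' t)\<^sup>2 - (b' t)\<^sup>2 = L\<^sup>2"
  shows "\<exists>g \<in> hyp_curves x y. hyp_length g = L"
proof -
  define g where "g t = a t *\<^sub>R x + b t *\<^sub>R y" for t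
  define v where "v t = a' t *\<^sub>R x + b' t *\<^sub>R y" for t
  have xy: "x $ 0 > 0" "y $ 0 > 0" "x \<bullet>\<^sub>M x = - 1" "y \<bullet>\<^sub>M y = - 1"
    using assms(1,2) by (auto simp: hyp3_def)
  have deriv: "(g has_vector_derivative v t) (at t)" for t
    unfolding g_def v_def using da[of t] db[of t]
    by (auto intro!: derivative_eq_intros simp: has_real_derivative_iff_has_vector_derivative)
  have "continuous_on UNIV v"
    unfolding v_def by (intro continuous_intros cont)
  with deriv have "g C1_differentiable_on {0..1}"
    unfolding C1_differentiable_on_def by (blast intro: continuous_on_subset)
  then have path: "valid_path g"
    by (simp add: valid_path_def C1_differentiable_imp_piecewise)
  have "g t \<in> hyp3" if t: "t \<in> {0..1}" for t
  proof -
    have "a t \<noteq> 0 \<or> b t \<noteq> 0"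
      using unit[of t] by auto
    with nonneg[OF t] have "(a t > 0 \<and> b t \<ge> 0) \<or> (a t \<ge> 0 \<and> b t > 0)"
      by auto
    then have "g t $ 0 > 0"
      using xy(1,2) by (auto simp: g_def intro: add_pos_nonneg add_nonneg_pos)
    moreover have "g t \<bullet>\<^sub>M g t = - ((a t)\<^sup>2 + (b t)\<^sup>2 - 2 * a t * b t * (x \<bullet>\<^sub>M y))"
      by (simp add: g_def mink_simps xy(3,4) mink_commute[of y x] power2_eq_square algebra_simps)
    then have "g t \<bullet>\<^sub>M g t = - 1"
      by (simp only: unit)
    ultimately show ?thesis
      by (simp add: hyp3_def)
  qed
  then have image: "path_image g \<subseteq> hyp3"
    by (auto simp: path_image_def)
  have "hyp_speed g t = L" if "t \<in> {0..1}" for t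
  proof -
    have "vector_derivative g (at t within {0..1}) = v t"
      using that deriv by (intro vector_derivative_at_within_ivl) auto
    moreover have "v t \<bullet>\<^sub>M v t = 2 * a' t * b' t * (x \<bullet>\<^sub>M y) - (a' t)\<^sup>2 - (b' t)\<^sup>2"
      by (simp add: v_def mink_simps xy(3,4) mink_commute[of y x] power2_eq_square algebra_simps)
    then have "v t \<bullet>\<^sub>M v t = L\<^sup>2"
      by (simp only: speed)
    ultimately show ?thesis
      using L by (simp add: hyp_speed_def)
  qed
  then have "(hyp_speed g has_integral L) {0..1}"
    using has_integral_const_real[of L 0 1] by (auto intro: has_integral_eq)
  then have "hyp_speed g integrable_on {0..1}" "hyp_length g = L"
    by (auto simp: hyp_length_def integrable_on_def integral_unique)
  with path image show ?thesis
    by (intro bexI[of _ g]) (auto simp: hyp_curves_def pathstart_def pathfinish_def g_def ends)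
qed

lemma sinh_add_identity:
  fixes u v :: real
  shows "(sinh u)\<^sup>2 + (sinh v)\<^sup>2 + 2 * sinh u * sinh v * cosh (u + v) = (sinh (u + v))\<^sup>2"
proof -
  have "2 * sinh u * sinh v * cosh (u + v)
      = 2 * (sinh u)\<^sup>2 * (sinh v)\<^sup>2 + 2 * (sinh u * cosh v) * (cosh u * sinh v)"
    by (simp add: cosh_add algebra_simps power2_eq_square)
  then show ?thesis
    unfolding sinh_add power2_sum power_mult_distrib cosh_square_eq
    by (simp add: algebra_simps)
qed

lemma cosh_add_identity:
  fixes u v :: real
  shows "2 * cosh u * cosh v * cosh (u + v) - (cosh u)\<^sup>2 - (cosh v)\<^sup>2 = (sinh (u + v))\<^sup>2"
proof -
  have "2 * cosh u * cosh v * cosh (u + v)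
      = 2 * (cosh u)\<^sup>2 * (cosh v)\<^sup>2 + 2 * (sinh u * cosh v) * (cosh u * sinh v)"
    by (simp add: cosh_add algebra_simps power2_eq_square)
  then show ?thesis
    unfolding sinh_add power2_sum power_mult_distrib cosh_square_eq
    by (simp add: algebra_simps)
qed

text \<open>
  The geodesic is the hyperbolic analogue of spherical linear interpolation,
  with coefficients \<open>sinh ((1 - t) d) / sinh d\<close> and \<open>sinh (t d) / sinh d\<close>. For \<open>d = 0\<close> their limits
  \<open>1 - t\<close> and \<open>t\<close> serve instead; this avoids having to show \<open>x = y\<close> from \<open>x \<bullet>\<^sub>M y = - 1\<close>.
\<close>
lemma geodesic_curve:
  assumes "x \<in> hyp3" "y \<in> hyp3"
  shows "\<exists>g \<in> hyp_curves x y. hyp_length g = arcosh (- (x \<bullet>\<^sub>M y))"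
proof -
  define d where "d = arcosh (- (x \<bullet>\<^sub>M y))"
  have ge1: "- (x \<bullet>\<^sub>M y) \<ge> 1"
    using hyp3_mink_le[OF assms] by simp
  then have d: "d \<ge> 0" and c: "x \<bullet>\<^sub>M y = - cosh d"
    by (auto simp: d_def simp del: arcosh_real_gt_1_iff)
  show ?thesis unfolding d_def[symmetric]
  proof (cases "d = 0")
    case True
    show "\<exists>g \<in> hyp_curves x y. hyp_length g = d"
      by (rule hyp_curve_combination[OF assms d, of "\<lambda>t. 1 - t" "\<lambda>_. - 1" "\<lambda>t. t" "\<lambda>_. 1"])
        (auto intro!: derivative_eq_intros continuous_intros simp: c True power2_eq_square algebra_simps)
  next
    case False
    with d have pos: "d > 0" "sinh d > 0" by auto
    show "\<exists>g \<in> hyp_curves x y. hyp_length g = d"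
    proof (rule hyp_curve_combination[OF assms d])
      fix t :: real
      let ?u = "(1 - t) * d" and ?v = "t * d"
      have uv: "?u + ?v = d"
        by (simp add: algebra_simps)
      show "((\<lambda>t. sinh ((1 - t) * d) / sinh d) has_real_derivative - (d * cosh ?u) / sinh d) (at t)"
        using pos by (auto intro!: derivative_eq_intros)
      show "((\<lambda>t. sinh (t * d) / sinh d) has_real_derivative d * cosh ?v / sinh d) (at t)"
        using pos by (auto intro!: derivative_eq_intros)
      show "(sinh ?u / sinh d)\<^sup>2 + (sinh ?v / sinh d)\<^sup>2 - 2 * (sinh ?u / sinh d) * (sinh ?v / sinh d) * (x \<bullet>\<^sub>M y) = 1"
        using sinh_add_identity[of ?u ?v] pos unfolding uv c
        by (simp add: power_divide add_divide_distrib[symmetric] power2_eq_square mult.assoc field_simps)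
      show "2 * (- (d * cosh ?u) / sinh d) * (d * cosh ?v / sinh d) * (x \<bullet>\<^sub>M y)
          - (- (d * cosh ?u) / sinh d)\<^sup>2 - (d * cosh ?v / sinh d)\<^sup>2 = d\<^sup>2"
      proof -
        have "2 * (- (d * cosh ?u) / sinh d) * (d * cosh ?v / sinh d) * (x \<bullet>\<^sub>M y)
            - (- (d * cosh ?u) / sinh d)\<^sup>2 - (d * cosh ?v / sinh d)\<^sup>2
          = (d / sinh d)\<^sup>2 * (2 * cosh ?u * cosh ?v * cosh (?u + ?v) - (cosh ?u)\<^sup>2 - (cosh ?v)\<^sup>2)"
          unfolding uv c by (simp add: power2_eq_square right_diff_distrib mult_ac)
        also have "\<dots> = d\<^sup>2"
          unfolding cosh_add_identity unfolding uv using pos by (simp add: power_divide)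
        finally show ?thesis .
      qed
    qed (use pos in \<open>auto intro!: continuous_intros\<close>)
  qed
qed

text \<open>
  The length dominates the change of \<open>arsinh (g \<bullet>\<^sub>M e)\<close> for a unit vector \<open>e\<close> and, with the opposite sign,
  for \<open>- e\<close>.
\<close>
lemma hyp_length_nonneg:
  assumes "g \<in> hyp_curves x y"
  shows "hyp_length g \<ge> 0"
proof -
  have e: "axis 1 1 \<bullet>\<^sub>M axis (1 :: 4) (1 :: real) = 1"
    by (simp add: mink_def axis_def)
  have "(- axis 1 1) \<bullet>\<^sub>M (- axis (1 :: 4) (1 :: real)) = 1"
    by (simp add: mink_simps e)
  from arsinh_mink_le_length[OF assms e] arsinh_mink_le_length[OF assms this] show ?thesis
    by (simp add: mink_simps)
qed

lemma arsinh_mink_lipschitz: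
  assumes "x \<in> hyp3" "y \<in> hyp3" "n \<bullet>\<^sub>M n = 1"
  shows "\<bar>arsinh (y \<bullet>\<^sub>M n) - arsinh (x \<bullet>\<^sub>M n)\<bar> \<le> hyp_dist x y"
  unfolding hyp_dist_def
proof (rule cINF_greatest)
  show "hyp_curves x y \<noteq> {}"
    using geodesic_curve[OF assms(1,2)] by blast
  fix g assume g: "g \<in> hyp_curves x y"
  have "(- n) \<bullet>\<^sub>M (- n) = 1"
    by (simp add: mink_simps assms(3))
  from arsinh_mink_le_length[OF g assms(3)] arsinh_mink_le_length[OF g this]
  show "\<bar>arsinh (y \<bullet>\<^sub>M n) - arsinh (x \<bullet>\<^sub>M n)\<bar> \<le> hyp_length g"
    by (simp add: mink_simps)
qed

text \<open>
  The geodesic gives the upper bound. For the lower bound, \<open>n = (y - cosh d x) / sinh d\<close> is the initial unit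
  tangent vector of the geodesic; it satisfies \<open>x \<bullet>\<^sub>M n = 0\<close> and \<open>y \<bullet>\<^sub>M n = sinh d\<close>.
\<close>
lemma hyp_dist_eq_arcosh:
  assumes "x \<in> hyp3" "y \<in> hyp3"
  shows "hyp_dist x y = arcosh (- (x \<bullet>\<^sub>M y))"
proof (rule antisym)
  have bdd: "bdd_below (hyp_length ` hyp_curves x y)"
    by (rule bdd_belowI2[of _ 0]) (rule hyp_length_nonneg)
  obtain g where "g \<in> hyp_curves x y" "hyp_length g = arcosh (- (x \<bullet>\<^sub>M y))"
    using geodesic_curve[OF assms] by blast
  then show "hyp_dist x y \<le> arcosh (- (x \<bullet>\<^sub>M y))"
    unfolding hyp_dist_def by (metis cINF_lower[OF bdd])
  have nonneg: "0 \<le> hyp_dist x y"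
    unfolding hyp_dist_def
    by (rule cINF_greatest) (use geodesic_curve[OF assms] hyp_length_nonneg in blast)+
  define d where "d = arcosh (- (x \<bullet>\<^sub>M y))"
  have ge1: "- (x \<bullet>\<^sub>M y) \<ge> 1"
    using hyp3_mink_le[OF assms] by simp
  then have d: "d \<ge> 0" and c: "x \<bullet>\<^sub>M y = - cosh d"
    by (auto simp: d_def simp del: arcosh_real_gt_1_iff)
  show "arcosh (- (x \<bullet>\<^sub>M y)) \<le> hyp_dist x y"
    unfolding d_def[symmetric]
  proof (cases "d = 0")
    case False
    with d have pos: "sinh d > 0" by auto
    define n where "n = (1 / sinh d) *\<^sub>R (y - cosh d *\<^sub>R x)"
    have xy: "x \<bullet>\<^sub>M x = - 1" "y \<bullet>\<^sub>M y = - 1"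
      using assms by (auto simp: hyp3_def)
    have "x \<bullet>\<^sub>M n = 0"
      by (simp add: n_def mink_simps xy c)
    moreover have yn: "y \<bullet>\<^sub>M n = sinh d"
      using pos by (simp add: n_def mink_simps xy c mink_commute[of y x] cosh_square_eq
          power2_eq_square[symmetric] field_simps)
    moreover have "n \<bullet>\<^sub>M n = 1"
    proof -
      have "n \<bullet>\<^sub>M n = (1 / sinh d) * (y \<bullet>\<^sub>M n - cosh d * (x \<bullet>\<^sub>M n))"
        by (subst n_def) (simp add: mink_simps)
      then show ?thesis
        using pos calculation by simp
    qed
    ultimately show "d \<le> hyp_dist x y"
      using arsinh_mink_lipschitz[OF assms, of n] d by (simp add: arsinh_sinh_real)
  qed (use nonneg in simp)
qed

section \<open>Distances between sets\<close>

lemma hyp_setdist_eqI: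
  assumes "\<And>a b. a \<in> A \<Longrightarrow> b \<in> B \<Longrightarrow> D \<le> hyp_dist a b"
    and "\<And>e. e > 0 \<Longrightarrow> \<exists>a\<in>A. \<exists>b\<in>B. hyp_dist a b < D + e"
  shows "hyp_setdist A B = D"
  unfolding hyp_setdist_def
proof (rule cInf_eq)
  fix r assume r: "\<And>d. d \<in> {hyp_dist a b |a b. a \<in> A \<and> b \<in> B} \<Longrightarrow> r \<le> d"
  show "r \<le> D"
  proof (rule field_le_epsilon)
    fix e :: real assume "e > 0"
    then obtain a b where ab: "a \<in> A" "b \<in> B" "hyp_dist a b < D + e"
      using assms(2) by blast
    then have "r \<le> hyp_dist a b"
      using r by blast
    with ab(3) show "r \<le> D + e"
      by linarith
  qed
qed (use assms(1) in blast)

text \<open>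
  The bound \<open>C \<ge> 1\<close> is part of the conclusion because the formula for two lines needs it:
  it is obtained there without any inequality between cross ratios.
\<close>
lemma hyp_setdist_arcoshI:
  assumes "A \<subseteq> hyp3" "B \<subseteq> hyp3"
    and lower: "\<And>a b. a \<in> A \<Longrightarrow> b \<in> B \<Longrightarrow> C \<le> - (a \<bullet>\<^sub>M b)"
    and approx: "\<And>e. e > 0 \<Longrightarrow> \<exists>a\<in>A. \<exists>b\<in>B. - (a \<bullet>\<^sub>M b) < C + e"
  shows "C \<ge> 1" and "hyp_setdist A B = arcosh C"
proof -
  have ge1: "- (a \<bullet>\<^sub>M b) \<ge> 1" if "a \<in> A" "b \<in> B" for a b
    using hyp3_mink_le[of a b] that assms(1,2) by auto
  show C: "C \<ge> 1"
  proof (rule field_le_epsilon)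
    fix e :: real assume "e > 0"
    from approx[OF this] ge1 show "1 \<le> C + e"
      by fastforce
  qed
  have dist: "hyp_dist a b = arcosh (- (a \<bullet>\<^sub>M b))" if "a \<in> A" "b \<in> B" for a b
    using that assms(1,2) by (intro hyp_dist_eq_arcosh) auto
  show "hyp_setdist A B = arcosh C"
  proof (rule hyp_setdist_eqI)
    fix a b assume ab: "a \<in> A" "b \<in> B"
    show "arcosh C \<le> hyp_dist a b"
      using lower[OF ab] C ge1[OF ab] arcosh_less_iff_real[of "- (a \<bullet>\<^sub>M b)" C]
      by (simp add: dist[OF ab] not_less[symmetric])
  next
    fix e :: real assume e: "e > 0"
    \<comment> \<open>monotonicity of \<open>cosh\<close> gives the slack, so continuity of \<open>arcosh\<close> at \<open>1\<close> is not an issue\<close>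
    have "cosh (arcosh C) < cosh (arcosh C + e)"
      using e C by (intro cosh_real_strict_mono) auto
    then have "cosh (arcosh C + e) - C > 0"
      using C by simp
    from approx[OF this] obtain a b where ab: "a \<in> A" "b \<in> B" "- (a \<bullet>\<^sub>M b) < cosh (arcosh C + e)"
      by auto
    have "arcosh (- (a \<bullet>\<^sub>M b)) < arcosh (cosh (arcosh C + e))"
      using ab ge1 by (intro arcosh_real_strict_mono) auto
    also have "\<dots> = arcosh C + e"
      using C e by (intro arcosh_cosh_real add_nonneg_nonneg) auto
    finally show "\<exists>a\<in>A. \<exists>b\<in>B. hyp_dist a b < arcosh C + e"
      using ab dist by auto
  qed
qed

text \<open>
  The foot of the perpendicular is the normalisation of the projection \<open>x - (x \<bullet>\<^sub>M n) n\<close>.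
\<close>
lemma plane_foot:
  assumes "x \<in> hyp3" "n \<bullet>\<^sub>M n = 1"
  shows "\<exists>y \<in> hyp_plane n. hyp_dist x y = arsinh \<bar>x \<bullet>\<^sub>M n\<bar>"
proof -
  define c where "c = x \<bullet>\<^sub>M n"
  define z where "z = x - c *\<^sub>R n"
  have xx: "x \<bullet>\<^sub>M x = - 1"
    using assms(1) by (simp add: hyp3_def)
  have zz: "z \<bullet>\<^sub>M z = - (c\<^sup>2 + 1)" and xz: "x \<bullet>\<^sub>M z = - (c\<^sup>2 + 1)" and zn: "z \<bullet>\<^sub>M n = 0"
    by (simp_all add: z_def mink_simps assms(2) xx c_def mink_commute[of n x] power2_eq_square)
  have pos: "c\<^sup>2 + 1 > 0"
    by (simp add: add_nonneg_pos)
  define y where "y = z /\<^sub>R sqrt (- (z \<bullet>\<^sub>M z))"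
  have y: "y \<in> hyp3"
    unfolding y_def by (rule hyp3_normalizeI[OF assms(1)]) (use pos in \<open>simp_all add: zz xz\<close>)
  have "- (x \<bullet>\<^sub>M y) = (c\<^sup>2 + 1) / sqrt (c\<^sup>2 + 1)"
    by (simp add: y_def zz mink_simps xz divide_inverse algebra_simps)
  also have "\<dots> = sqrt (c\<^sup>2 + 1)"
    using pos by (simp add: real_div_sqrt)
  also have "\<dots> = cosh (arsinh \<bar>c\<bar>)"
    by (simp add: cosh_arsinh_real)
  finally have "hyp_dist x y = arcosh (cosh (arsinh \<bar>c\<bar>))"
    by (simp add: hyp_dist_eq_arcosh[OF assms(1) y])
  also have "\<dots> = arsinh \<bar>c\<bar>"
    by (intro arcosh_cosh_real) (simp add: not_less[symmetric])
  finally show ?thesis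
    using y by (intro bexI[of _ y]) (auto simp: hyp_plane_def c_def y_def mink_simps zn)
qed

lemma arsinh_abs: "\<bar>arsinh s\<bar> = arsinh \<bar>s\<bar>" for s :: real
  by (auto simp: abs_if)

text \<open>
  Only the values \<open>\<bar>a \<bullet>\<^sub>M n\<bar>\<close> for \<open>a \<in> A\<close> matter, because the Lipschitz bound with respect to \<open>n\<close> is attained at
  the foot of the perpendicular.
\<close>
lemma hyp_setdist_planeI:
  assumes "A \<subseteq> hyp3" "n \<bullet>\<^sub>M n = 1"
    and lower: "\<And>a. a \<in> A \<Longrightarrow> C \<le> \<bar>a \<bullet>\<^sub>M n\<bar>"
    and approx: "\<And>e. e > 0 \<Longrightarrow> \<exists>a\<in>A. \<bar>a \<bullet>\<^sub>M n\<bar> < C + e"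
  shows "hyp_setdist A (hyp_plane n) = arsinh C"
proof (rule hyp_setdist_eqI)
  fix a b assume ab: "a \<in> A" "b \<in> hyp_plane n"
  then have "\<bar>arsinh (a \<bullet>\<^sub>M n)\<bar> \<le> hyp_dist a b"
    using arsinh_mink_lipschitz[of a b n] assms(1,2) by (auto simp: hyp_plane_def)
  moreover have "arsinh C \<le> arsinh \<bar>a \<bullet>\<^sub>M n\<bar>"
    using lower[OF ab(1)] arsinh_less_iff_real[of "\<bar>a \<bullet>\<^sub>M n\<bar>" C] by (simp add: not_less[symmetric])
  ultimately show "arsinh C \<le> hyp_dist a b"
    by (simp add: arsinh_abs)
next
  fix e :: real assume e: "e > 0"
  have "sinh (arsinh C) < sinh (arsinh C + e)"
    using e unfolding sinh_real_less_iff by simp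
  then have "sinh (arsinh C + e) - C > 0"
    by simp
  from approx[OF this] obtain a where a: "a \<in> A" "\<bar>a \<bullet>\<^sub>M n\<bar> < sinh (arsinh C + e)"
    by auto
  then have "arsinh \<bar>a \<bullet>\<^sub>M n\<bar> < arsinh (sinh (arsinh C + e))"
    by (simp only: arsinh_less_iff_real)
  then have "arsinh \<bar>a \<bullet>\<^sub>M n\<bar> < arsinh C + e"
    by (simp only: arsinh_sinh_real)
  moreover obtain b where "b \<in> hyp_plane n" "hyp_dist a b = arsinh \<bar>a \<bullet>\<^sub>M n\<bar>"
    using plane_foot[of a n] a(1) assms(1,2) by blast
  ultimately show "\<exists>a\<in>A. \<exists>b\<in>hyp_plane n. hyp_dist a b < arsinh C + e"
    using a(1) by force
qed

section \<open>Lines\<close>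

text \<open>
  The parametrisation of a line for which \<open>ln u\<close> is the signed arc length from the point \<open>u = 1\<close>.
\<close>
definition line_point :: "real ^ 4 \<Rightarrow> real ^ 4 \<Rightarrow> real \<Rightarrow> real ^ 4" where
  "line_point a b u = (1 / sqrt (- 2 * (a \<bullet>\<^sub>M b))) *\<^sub>R (u *\<^sub>R a + (1 / u) *\<^sub>R b)"

text \<open>
  The hypothesis amounts to \<open>u = sqrt ((1 - s) / s)\<close>. Then the normalising factor
  \<open>sqrt (s (1 - s))\<close> equals \<open>u s\<close>, and the two coefficients become reciprocal to each other up to
  a constant.
\<close>
lemma hyp_normalize_segment:
  assumes "a \<in> light_cone" "b \<in> light_cone" "a \<bullet>\<^sub>M b < 0" "s > 0" "u > 0" "u\<^sup>2 * s = 1 - s"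
  shows "hyp_normalize ((1 - s) *\<^sub>R a + s *\<^sub>R b) = line_point a b u"
proof -
  define r where "r = sqrt (- 2 * (a \<bullet>\<^sub>M b))"
  have r: "r > 0" "r\<^sup>2 = - 2 * (a \<bullet>\<^sub>M b)"
    using assms(3) by (simp_all add: r_def)
  have null: "a \<bullet>\<^sub>M a = 0" "b \<bullet>\<^sub>M b = 0"
    using assms(1,2) by (auto simp: light_cone_def)
  define y where "y = (1 - s) *\<^sub>R a + s *\<^sub>R b"
  have "- (y \<bullet>\<^sub>M y) = s * (1 - s) * (- 2 * (a \<bullet>\<^sub>M b))"
    by (simp add: y_def mink_simps null mink_commute[of b a])
  also have "\<dots> = (u * s * r)\<^sup>2"
    unfolding r(2)[symmetric] assms(6)[symmetric] by (simp add: power2_eq_square)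
  finally have "sqrt (- (y \<bullet>\<^sub>M y)) = u * s * r"
    using assms(4,5) r(1) by simp
  then have "hyp_normalize y = inverse (u * s * r) *\<^sub>R ((u\<^sup>2 * s) *\<^sub>R a + s *\<^sub>R b)"
    by (simp add: hyp_normalize_def y_def assms(6))
  also have "\<dots> = (1 / r) *\<^sub>R (u *\<^sub>R a + (1 / u) *\<^sub>R b)"
    using assms(4,5) r(1) by (simp add: scaleR_add_right power2_eq_square field_simps)
  finally show ?thesis
    by (simp add: y_def line_point_def r_def)
qed

lemma hyp_line_eq:
  assumes "a \<in> light_cone" "b \<in> light_cone" "a \<bullet>\<^sub>M b < 0"
  shows "hyp_line a b = line_point a b ` {0<..}"
proof (intro equalityI subsetI)
  fix p assume "p \<in> hyp_line a b"
  then obtain s where s: "0 < s" "s < 1" "p = hyp_normalize ((1 - s) *\<^sub>R a + s *\<^sub>R b)"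
    by (auto simp: hyp_line_def)
  have "p = line_point a b (sqrt ((1 - s) / s))"
    unfolding s(3) by (rule hyp_normalize_segment[OF assms]) (use s in auto)
  then show "p \<in> line_point a b ` {0<..}"
    using s by auto
next
  fix p assume "p \<in> line_point a b ` {0<..}"
  then obtain u where u: "u > 0" "p = line_point a b u"
    by auto
  define s where "s = 1 / (1 + u\<^sup>2)"
  have pos: "1 + u\<^sup>2 > 0" "u\<^sup>2 > 0"
    using u by (simp_all add: add_pos_pos)
  have s: "0 < s" "s < 1"
    unfolding s_def divide_less_eq_1_pos[OF pos(1)] less_add_same_cancel1 using pos(2)
    by (auto simp only: divide_pos_pos[OF zero_less_one pos(1)])
  have "s * (1 + u\<^sup>2) = 1"
    using pos(1) by (simp add: s_def)
  then have "u\<^sup>2 * s = 1 - s"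
    by (simp add: algebra_simps)
  note s = s this
  have "p = hyp_normalize ((1 - s) *\<^sub>R a + s *\<^sub>R b)"
    unfolding u(2) by (rule hyp_normalize_segment[OF assms s(1) u(1) s(3), symmetric])
  with s show "p \<in> hyp_line a b"
    by (auto simp: hyp_line_def)
qed

lemma line_point_mink:
  "line_point a b u \<bullet>\<^sub>M z = (u * (a \<bullet>\<^sub>M z) + (b \<bullet>\<^sub>M z) / u) / sqrt (- 2 * (a \<bullet>\<^sub>M b))"
  by (simp add: line_point_def mink_simps)

lemma line_point_in_hyp3:
  assumes "a \<in> light_cone" "b \<in> light_cone" "a \<bullet>\<^sub>M b < 0" "u > 0"
  shows "line_point a b u \<in> hyp3"
proof -
  have ab: "a $ 0 > 0" "b $ 0 > 0" "a \<bullet>\<^sub>M a = 0" "b \<bullet>\<^sub>M b = 0"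
    using assms(1,2) by (auto simp: light_cone_def)
  define y where "y = u *\<^sub>R a + (1 / u) *\<^sub>R b"
  define r where "r = sqrt (- 2 * (a \<bullet>\<^sub>M b))"
  have r: "r > 0" "r\<^sup>2 = - 2 * (a \<bullet>\<^sub>M b)"
    using assms(3) by (simp_all add: r_def)
  have yy: "y \<bullet>\<^sub>M y = - (r\<^sup>2)"
    using assms(4) unfolding r(2) by (simp add: y_def mink_simps ab mink_commute[of b a])
  have "y $ 0 > 0"
    using ab assms(4) by (simp add: y_def add_pos_pos)
  moreover have "((1 / r) *\<^sub>R y) \<bullet>\<^sub>M ((1 / r) *\<^sub>R y) = - 1"
    using r(1) by (simp add: mink_simps yy power2_eq_square)
  ultimately show ?thesis
    unfolding line_point_def y_def[symmetric] r_def[symmetric] using r(1) by (simp add: hyp3_def)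
qed

lemma hyp_line_subset:
  assumes "a \<in> light_cone" "b \<in> light_cone" "a \<bullet>\<^sub>M b < 0"
  shows "hyp_line a b \<subseteq> hyp3"
  using line_point_in_hyp3[OF assms] by (auto simp: hyp_line_eq[OF assms])

lemma amgm_le:
  fixes p q u :: real
  assumes "p \<ge> 0" "q \<ge> 0" "u > 0"
  shows "2 * sqrt (p * q) \<le> u * p + q / u"
  using arith_geo_mean_sqrt[of "u * p" "q / u"] assms by simp

text \<open>
  For \<open>p, q > 0\<close> the value \<open>2 sqrt (p q)\<close> is attained at \<open>u = sqrt (q / p)\<close>; if exactly one of them vanishes,
  it is only approached, as \<open>u\<close> tends to \<open>0\<close> or to infinity.
\<close>
lemma amgm_approx:
  fixes p q e :: real
  assumes "p \<ge> 0" "q \<ge> 0" "e > 0"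
  shows "\<exists>u>0. u * p + q / u < 2 * sqrt (p * q) + e"
proof -
  consider "p = 0" | "q = 0" | "p > 0" "q > 0"
    using assms by fastforce
  then show ?thesis
  proof cases
    case 1
    have "q / ((q + 1) / e) < e"
      using assms by (simp add: field_simps)
    with 1 assms show ?thesis
      by (intro exI[of _ "(q + 1) / e"]) auto
  next
    case 2
    have "(e / (p + 1)) * p < e"
      using assms by (simp add: field_simps)
    with 2 assms show ?thesis
      by (intro exI[of _ "e / (p + 1)"]) auto
  next
    case 3
    have "sqrt (q / p) * p = sqrt (p * q)" "q / sqrt (q / p) = sqrt (p * q)"
      using 3 real_div_sqrt[of p] real_div_sqrt[of q]
      by (simp_all add: real_sqrt_divide real_sqrt_mult field_simps)
    with 3 assms show ?thesis
      by (intro exI[of _ "sqrt (q / p)"]) auto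
  qed
qed

lemma sqrt_quotient:
  fixes p q c :: real
  assumes "c < 0"
  shows "sqrt (- 2 * ((p * q) / c)) = 2 * sqrt (p * q) / sqrt (- 2 * c)"
proof -
  have "- 2 * ((p * q) / c) = 4 * (p * q) / (- 2 * c)"
    using assms by (simp add: field_simps)
  also have "sqrt \<dots> = sqrt 4 * sqrt (p * q) / sqrt (- 2 * c)"
    by (simp only: real_sqrt_divide real_sqrt_mult)
  finally show ?thesis
    by simp
qed

lemma point_line_distance:
  assumes "x \<in> hyp3" "a \<in> light_cone" "b \<in> light_cone" "a \<bullet>\<^sub>M b < 0"
  shows "hyp_setdist {x} (hyp_line a b) =
    arcosh (sqrt (- 2 * (((a \<bullet>\<^sub>M x) * (x \<bullet>\<^sub>M b)) / (a \<bullet>\<^sub>M b))))"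
proof -
  define p q r where "p = - (a \<bullet>\<^sub>M x)" and "q = - (x \<bullet>\<^sub>M b)" and "r = sqrt (- 2 * (a \<bullet>\<^sub>M b))"
  have p: "p > 0"
    using mink_hyp3_neg[OF assms(1), of a] assms(2) by (simp add: p_def light_cone_def mink_commute)
  have q: "q > 0"
    using mink_hyp3_neg[OF assms(1), of b] assms(3) by (simp add: q_def light_cone_def)
  have r: "r > 0"
    using assms(4) by (simp add: r_def)
  have mink: "- (x \<bullet>\<^sub>M line_point a b u) = (u * p + q / u) / r" for u
    unfolding mink_commute[of x "line_point a b u"] line_point_mink r_def[symmetric]
    by (simp add: p_def q_def mink_commute[of b x] add_divide_distrib diff_divide_distrib)
  have C: "sqrt (- 2 * (((a \<bullet>\<^sub>M x) * (x \<bullet>\<^sub>M b)) / (a \<bullet>\<^sub>M b))) = 2 * sqrt (p * q) / r"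
    using sqrt_quotient[OF assms(4)] by (simp add: p_def q_def r_def)
  show ?thesis
    unfolding C
  proof (rule hyp_setdist_arcoshI)
    fix y z assume "y \<in> {x}" "z \<in> hyp_line a b"
    then obtain u where "u > 0" "y = x" "z = line_point a b u"
      by (auto simp: hyp_line_eq[OF assms(2-4)])
    then show "2 * sqrt (p * q) / r \<le> - (y \<bullet>\<^sub>M z)"
      using amgm_le[of p q u] p q r by (simp add: mink divide_right_mono)
  next
    fix e :: real assume "e > 0"
    then obtain u where u: "u > 0" "u * p + q / u < 2 * sqrt (p * q) + e * r"
      using amgm_approx[of p q "e * r"] p q r by auto
    have "(u * p + q / u) / r < 2 * sqrt (p * q) / r + e"
      using u(2) r by (simp add: pos_divide_less_eq distrib_right)
    then show "\<exists>y\<in>{x}. \<exists>z\<in>hyp_line a b. - (y \<bullet>\<^sub>M z) < 2 * sqrt (p * q) / r + e"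
      using u(1) by (auto simp: hyp_line_eq[OF assms(2-4)] mink)
  qed (use assms hyp_line_subset in auto)
qed

lemma arcosh_eq_arsinh:
  fixes l :: real
  assumes "l \<ge> 1"
  shows "arcosh l = 2 * arsinh (sqrt ((l - 1) / 2))"
proof -
  define t where "t = arsinh (sqrt ((l - 1) / 2))"
  have t: "t \<ge> 0"
    using assms by (simp add: t_def not_less[symmetric])
  have "cosh (2 * t) = 2 * (sinh t)\<^sup>2 + 1"
    by (simp add: cosh_double cosh_square_eq)
  also have "\<dots> = l"
    using assms by (simp add: t_def field_simps)
  finally show ?thesis
    using arcosh_cosh_real[of "2 * t"] t by (simp add: t_def)
qed

text \<open>
  The product of the points with parameters \<open>u\<close> and \<open>v\<close> involves only \<open>u v\<close> and \<open>u / v\<close>, which range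
  independently over the positive reals, so the two summands can be minimised separately.
\<close>
lemma line_line_distance:
  assumes a: "a \<in> light_cone" "b \<in> light_cone" "a \<bullet>\<^sub>M b < 0"
    and c: "c \<in> light_cone" "d \<in> light_cone" "c \<bullet>\<^sub>M d < 0"
  defines "l \<equiv> sqrt (((a \<bullet>\<^sub>M c) * (b \<bullet>\<^sub>M d)) / ((a \<bullet>\<^sub>M b) * (c \<bullet>\<^sub>M d)))
             + sqrt (((a \<bullet>\<^sub>M d) * (b \<bullet>\<^sub>M c)) / ((a \<bullet>\<^sub>M b) * (c \<bullet>\<^sub>M d)))"
  shows "hyp_setdist (hyp_line a b) (hyp_line c d) = 2 * arsinh (sqrt ((l - 1) / 2))"
proof -
  define p q p' q' where "p = - (a \<bullet>\<^sub>M c)" and "q = - (b \<bullet>\<^sub>M d)"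
    and "p' = - (a \<bullet>\<^sub>M d)" and "q' = - (b \<bullet>\<^sub>M c)"
  have nonneg: "p \<ge> 0" "q \<ge> 0" "p' \<ge> 0" "q' \<ge> 0"
    using light_cone_mink(1) a c by (auto simp: p_def q_def p'_def q'_def)
  define r where "r = sqrt (- 2 * (a \<bullet>\<^sub>M b)) * sqrt (- 2 * (c \<bullet>\<^sub>M d))"
  have r: "r > 0"
    using a c by (simp add: r_def)
  have "r = sqrt (4 * ((a \<bullet>\<^sub>M b) * (c \<bullet>\<^sub>M d)))"
    by (simp add: r_def flip: real_sqrt_mult)
  then have r2: "r = 2 * sqrt ((a \<bullet>\<^sub>M b) * (c \<bullet>\<^sub>M d))"
    by (simp add: real_sqrt_mult)
  have l: "l = (2 * sqrt (p * q) + 2 * sqrt (p' * q')) / r"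
    unfolding l_def r2 real_sqrt_divide p_def q_def p'_def q'_def
    by (simp add: add_divide_distrib)
  have mink: "- (line_point a b u \<bullet>\<^sub>M line_point c d v)
      = ((u * v * p + q / (u * v)) + (u / v * p' + q' / (u / v))) / r" if "u > 0" "v > 0" for u v
  proof -
    define R S where "R = sqrt (- 2 * (a \<bullet>\<^sub>M b))" and "S = sqrt (- 2 * (c \<bullet>\<^sub>M d))"
    have RS: "R > 0" "S > 0" "r = R * S"
      using a c by (simp_all add: R_def S_def r_def)
    have right: "z \<bullet>\<^sub>M line_point c d v = (v * (z \<bullet>\<^sub>M c) + (z \<bullet>\<^sub>M d) / v) / S" for z
      by (simp only: mink_commute[of z "line_point c d v"] line_point_mink
          mink_commute[of c z] mink_commute[of d z] S_def)
    have "- (line_point a b u \<bullet>\<^sub>M line_point c d v)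
      = - ((u * ((v * (- p) + (- p') / v) / S) + ((v * (- q') + (- q) / v) / S) / u) / R)"
      by (subst line_point_mink) (simp only: right R_def p_def q_def p'_def q'_def minus_minus)
    also have "\<dots> = ((u * v * p + q / (u * v)) + (u / v * p' + q' / (u / v))) / (R * S)"
      using that RS(1,2) by (simp add: field_simps)
    finally show ?thesis
      by (simp only: RS(3))
  qed
  have lower: "l \<le> - (x \<bullet>\<^sub>M y)" if "x \<in> hyp_line a b" "y \<in> hyp_line c d" for x y
  proof -
    from that obtain u v where uv: "u > 0" "v > 0" "x = line_point a b u" "y = line_point c d v"
      by (auto simp: hyp_line_eq[OF a] hyp_line_eq[OF c])
    have "2 * sqrt (p * q) \<le> u * v * p + q / (u * v)" "2 * sqrt (p' * q') \<le> u / v * p' + q' / (u / v)"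
      using uv nonneg by (intro amgm_le; simp)+
    then show ?thesis
      unfolding l uv(3,4) mink[OF uv(1,2)] using r by (intro divide_right_mono add_mono) auto
  qed
  have approx: "\<exists>x\<in>hyp_line a b. \<exists>y\<in>hyp_line c d. - (x \<bullet>\<^sub>M y) < l + e" if "e > 0" for e
  proof -
    have er: "e * r / 2 > 0"
      using that r by simp
    obtain w where w: "w > 0" "w * p + q / w < 2 * sqrt (p * q) + e * r / 2"
      using amgm_approx[OF nonneg(1,2) er] by auto
    obtain z where z: "z > 0" "z * p' + q' / z < 2 * sqrt (p' * q') + e * r / 2"
      using amgm_approx[OF nonneg(3,4) er] by auto
    \<comment> \<open>the solution of \<open>u * v = w\<close> and \<open>u / v = z\<close>\<close>
    define u v where "u = sqrt (w * z)" and "v = sqrt (w / z)"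
    have uv: "u > 0" "v > 0" "u * v = w" "u / v = z"
      using w(1) z(1) by (simp_all add: u_def v_def flip: real_sqrt_mult real_sqrt_divide)
    have "- (line_point a b u \<bullet>\<^sub>M line_point c d v) = ((w * p + q / w) + (z * p' + q' / z)) / r"
      unfolding mink[OF uv(1,2)] uv(3,4) ..
    also have "\<dots> < (2 * sqrt (p * q) + 2 * sqrt (p' * q') + e * r) / r"
      using w(2) z(2) r by (intro divide_strict_right_mono) auto
    also have "\<dots> = l + e"
      using r by (simp add: l add_divide_distrib)
    finally show ?thesis
      using uv(1,2) by (auto simp: hyp_line_eq[OF a] hyp_line_eq[OF c])
  qed
  note sub = hyp_line_subset[OF a] hyp_line_subset[OF c]
  show ?thesis
    using hyp_setdist_arcoshI(2)[OF sub lower approx] hyp_setdist_arcoshI(1)[OF sub lower approx]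
    by (simp add: arcosh_eq_arsinh)
qed

lemma point_plane_distance:
  assumes "x \<in> hyp3" "n \<bullet>\<^sub>M n = 1"
  shows "hyp_setdist {x} (hyp_plane n) = \<bar>arsinh (x \<bullet>\<^sub>M n)\<bar>"
  unfolding arsinh_abs by (rule hyp_setdist_planeI) (use assms in auto)

text \<open>
  If the ends lie strictly on the same side of the plane, both summands of \<open>u p + q / u\<close> have the same sign and
  the inequality of arithmetic and geometric means applies to the absolute values. If they lie on different sides,
  the line meets the plane. If one of the ends is an end of the plane, then the
  line approaches the plane asymptotically or lies in it.
\<close>
lemma line_plane_distance:
  assumes "a \<in> light_cone" "b \<in> light_cone" "a \<bullet>\<^sub>M b < 0" "n \<bullet>\<^sub>M n = 1"
  shows "hyp_setdist (hyp_line a b) (hyp_plane n) =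
    (if (a \<bullet>\<^sub>M n) * (n \<bullet>\<^sub>M b) > 0
     then arsinh (sqrt (- 2 * (((a \<bullet>\<^sub>M n) * (n \<bullet>\<^sub>M b)) / (a \<bullet>\<^sub>M b)))) else 0)"
proof -
  define p q r where "p = a \<bullet>\<^sub>M n" and "q = n \<bullet>\<^sub>M b" and "r = sqrt (- 2 * (a \<bullet>\<^sub>M b))"
  have r: "r > 0"
    using assms(3) by (simp add: r_def)
  have mink: "line_point a b u \<bullet>\<^sub>M n = (u * p + q / u) / r" for u
    by (simp add: line_point_mink p_def q_def r_def mink_commute[of b n])
  note line = hyp_line_eq[OF assms(1-3)] and sub = hyp_line_subset[OF assms(1-3)]
  show ?thesis
  proof (cases "p * q > 0")
    case True
    have abs: "\<bar>line_point a b u \<bullet>\<^sub>M n\<bar> = (u * \<bar>p\<bar> + \<bar>q\<bar> / u) / r" if "u > 0" for u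
    proof (cases "p > 0")
      case p: True
      with True have "q > 0" by (simp add: zero_less_mult_iff)
      with p that r show ?thesis by (simp add: mink add_pos_pos)
    next
      case False
      with True have pq: "p < 0" "q < 0" by (auto simp: zero_less_mult_iff)
      then have "u * p + q / u < 0"
        using that by (intro add_neg_neg mult_pos_neg divide_neg_pos)
      then have "line_point a b u \<bullet>\<^sub>M n < 0"
        unfolding mink using r by (simp add: divide_neg_pos)
      with pq show ?thesis by (simp add: mink add_divide_distrib diff_divide_distrib)
    qed
    have C: "sqrt (- 2 * ((p * q) / (a \<bullet>\<^sub>M b))) = 2 * sqrt (\<bar>p\<bar> * \<bar>q\<bar>) / r"
      using sqrt_quotient[OF assms(3), of p q] True by (simp add: r_def flip: abs_mult)
    have "hyp_setdist (hyp_line a b) (hyp_plane n) = arsinh (2 * sqrt (\<bar>p\<bar> * \<bar>q\<bar>) / r)"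
    proof (rule hyp_setdist_planeI[OF sub assms(4)])
      fix y assume "y \<in> hyp_line a b"
      then obtain u where u: "u > 0" "y = line_point a b u"
        by (auto simp: line)
      then show "2 * sqrt (\<bar>p\<bar> * \<bar>q\<bar>) / r \<le> \<bar>y \<bullet>\<^sub>M n\<bar>"
        using amgm_le[of "\<bar>p\<bar>" "\<bar>q\<bar>" u] r unfolding u(2) abs[OF u(1)] by (simp add: divide_right_mono)
    next
      fix e :: real assume "e > 0"
      then obtain u where u: "u > 0" "u * \<bar>p\<bar> + \<bar>q\<bar> / u < 2 * sqrt (\<bar>p\<bar> * \<bar>q\<bar>) + e * r"
        using amgm_approx[of "\<bar>p\<bar>" "\<bar>q\<bar>" "e * r"] r by auto
      have "(u * \<bar>p\<bar> + \<bar>q\<bar> / u) / r < 2 * sqrt (\<bar>p\<bar> * \<bar>q\<bar>) / r + e"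
        using u(2) r by (simp add: pos_divide_less_eq distrib_right)
      then show "\<exists>y\<in>hyp_line a b. \<bar>y \<bullet>\<^sub>M n\<bar> < 2 * sqrt (\<bar>p\<bar> * \<bar>q\<bar>) / r + e"
        by (intro bexI[of _ "line_point a b u"]) (use u(1) in \<open>simp_all add: abs line\<close>)
    qed
    with True C show ?thesis
      by (simp flip: p_def q_def)
  next
    case False
    have "hyp_setdist (hyp_line a b) (hyp_plane n) = arsinh 0"
    proof (rule hyp_setdist_planeI[OF sub assms(4)])
      fix e :: real assume e: "e > 0"
      have "\<exists>u>0. \<bar>u * p + q / u\<bar> < e * r"
      proof (cases "p * q = 0")
        case True
        then obtain u where u: "u > 0" "u * \<bar>p\<bar> + \<bar>q\<bar> / u < e * r"
          using amgm_approx[of "\<bar>p\<bar>" "\<bar>q\<bar>" "e * r"] e r by auto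
        then have "\<bar>u * p + q / u\<bar> \<le> u * \<bar>p\<bar> + \<bar>q\<bar> / u"
          using abs_triangle_ineq[of "u * p" "q / u"] by (simp add: abs_mult)
        with u show ?thesis
          by (intro exI[of _ u]) auto
      next
        case neq: False
        with False have "p * q < 0" by (metis linorder_neqE_linordered_idom)
        then have pq: "- q / p > 0"
          by (auto simp: mult_less_0_iff divide_less_0_iff)
        define u where "u = sqrt (- q / p)"
        have u: "u > 0" "u\<^sup>2 = - q / p"
          using pq by (simp_all add: u_def)
        have "u * p + q / u = (u\<^sup>2 * p + q) / u"
          using u(1) by (simp add: field_simps power2_eq_square)
        also have "\<dots> = 0"
          using neq by (simp add: u(2))
        finally show ?thesis
          using u(1) e r by auto
      qed
      then obtain u where u: "u > 0" "\<bar>u * p + q / u\<bar> < e * r"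
        by blast
      have "\<bar>line_point a b u \<bullet>\<^sub>M n\<bar> < e"
        using u(2) r by (simp add: mink abs_divide pos_divide_less_eq)
      then show "\<exists>y\<in>hyp_line a b. \<bar>y \<bullet>\<^sub>M n\<bar> < 0 + e"
        using u(1) by (auto simp: line)
    qed auto
    with False show ?thesis
      by (simp flip: p_def q_def)
  qed
qed

section \<open>Pairs of planes\<close>

lemma hyp_plane_nonempty:
  assumes "n \<bullet>\<^sub>M n = 1"
  shows "hyp_plane n \<noteq> {}"
proof -
  have "axis 0 1 \<in> hyp3"
    by (simp add: hyp3_def mink_def axis_def)
  from plane_foot[OF this assms] show ?thesis
    by blast
qed

text \<open>
  Equality in the reversed Cauchy-Schwarz inequality holds at the normalisation of \<open>m\<close> or \<open>- m\<close>,
  whichever is future-directed; the sign of its product with an auxiliary point \<open>w\<close> of the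
  plane decides.
\<close>
lemma plane_mink_attained:
  assumes "n \<bullet>\<^sub>M n = 1" "m \<bullet>\<^sub>M n = 0" "m \<bullet>\<^sub>M m < 0"
  shows "\<exists>y\<in>hyp_plane n. \<bar>y \<bullet>\<^sub>M m\<bar> = sqrt (- (m \<bullet>\<^sub>M m))"
proof -
  obtain w where w: "w \<in> hyp3"
    using hyp_plane_nonempty[OF assms(1)] by (auto simp: hyp_plane_def)
  have "m \<bullet>\<^sub>M w \<noteq> 0"
    using reverse_cauchy_schwarz[OF w, of m] assms(3) by auto
  then obtain \<sigma> :: real where \<sigma>: "\<sigma> = 1 \<or> \<sigma> = - 1" "\<sigma> * (m \<bullet>\<^sub>M w) < 0"
    by (metis linorder_neqE_linordered_idom mult_1 mult_minus_left neg_less_0_iff_less)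
  define z where "z = \<sigma> *\<^sub>R m"
  have zz: "z \<bullet>\<^sub>M z = m \<bullet>\<^sub>M m"
    using \<sigma>(1) by (auto simp: z_def mink_simps)
  define y where "y = z /\<^sub>R sqrt (- (z \<bullet>\<^sub>M z))"
  have "y \<in> hyp3"
    unfolding y_def by (rule hyp3_normalizeI[OF w])
      (use assms(3) \<sigma>(2) in \<open>simp_all only: zz, simp_all add: z_def mink_simps mink_commute[of w m]\<close>)
  moreover have "\<bar>y \<bullet>\<^sub>M m\<bar> = - (m \<bullet>\<^sub>M m) / sqrt (- (m \<bullet>\<^sub>M m))"
    using \<sigma>(1) assms(3) by (auto simp: y_def zz z_def mink_simps abs_mult divide_inverse)
  then have "\<bar>y \<bullet>\<^sub>M m\<bar> = sqrt (- (m \<bullet>\<^sub>M m))"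
    using assms(3) by (simp only: real_div_sqrt)
  ultimately show ?thesis
    by (intro bexI[of _ y]) (auto simp: hyp_plane_def y_def z_def mink_simps assms(2))
qed

text \<open>
  Starting from any point \<open>w\<close> of the plane, subtract a multiple of \<open>(w \<bullet>\<^sub>M m) m\<close> and normalise. For space-like
  \<open>m\<close>, a suitable multiple projects onto the orthogonal complement of \<open>m\<close>. For null \<open>m\<close>,
  the product with \<open>m\<close> does not change under the subtraction, but the
  norm grows with the multiple, and dividing by it makes the product small.
\<close>
lemma plane_mink_small:
  assumes "n \<bullet>\<^sub>M n = 1" "m \<bullet>\<^sub>M n = 0" "m \<bullet>\<^sub>M m \<ge> 0" "e > 0"
  shows "\<exists>y\<in>hyp_plane n. \<bar>y \<bullet>\<^sub>M m\<bar> < e"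
proof -
  obtain w where w: "w \<in> hyp3" "w \<bullet>\<^sub>M n = 0"
    using hyp_plane_nonempty[OF assms(1)] by (auto simp: hyp_plane_def)
  define c \<mu> where "c = w \<bullet>\<^sub>M m" and "\<mu> = m \<bullet>\<^sub>M m"
  \<comment> \<open>In the null case \<open>1 / e\<^sup>2\<close> is large enough for \<open>\<bar>c\<bar> / sqrt (1 + 2 T c\<^sup>2) < e\<close>.\<close>
  define T where "T = (if \<mu> = 0 then 1 / e\<^sup>2 else 1 / \<mu>)"
  have T: "T > 0"
    using assms(3,4) by (simp add: T_def \<mu>_def)
  define z where "z = w - (T * c) *\<^sub>R m"
  have ww: "w \<bullet>\<^sub>M w = - 1"
    using w by (simp add: hyp3_def)
  have wz: "w \<bullet>\<^sub>M z = - (1 + T * c\<^sup>2)"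
    by (simp add: z_def mink_simps ww c_def power2_eq_square)
  have zm: "z \<bullet>\<^sub>M m = c * (1 - T * \<mu>)"
    by (simp add: z_def mink_simps c_def \<mu>_def algebra_simps)
  have "z \<bullet>\<^sub>M z = w \<bullet>\<^sub>M z - (T * c) * (z \<bullet>\<^sub>M m)"
    unfolding mink_commute[of z m] by (subst z_def) (simp add: mink_simps)
  then have zz: "z \<bullet>\<^sub>M z = - (1 + T * c\<^sup>2 * (2 - T * \<mu>))"
    unfolding wz zm by (simp add: algebra_simps power2_eq_square)
  have T\<mu>: "T * \<mu> = 0 \<or> T * \<mu> = 1"
    by (simp add: T_def)
  have Tc: "T * c\<^sup>2 \<ge> 0"
    using T by simp
  have zz_neg: "z \<bullet>\<^sub>M z < 0"
    unfolding zz using T\<mu> Tc by auto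
  define y where "y = z /\<^sub>R sqrt (- (z \<bullet>\<^sub>M z))"
  have "y \<in> hyp3"
    unfolding y_def by (rule hyp3_normalizeI[OF w(1) zz_neg]) (use Tc in \<open>simp add: wz\<close>)
  moreover have "y \<bullet>\<^sub>M n = 0"
    by (simp add: y_def z_def mink_simps w(2) assms(2))
  moreover have "\<bar>y \<bullet>\<^sub>M m\<bar> < e"
  proof (cases "\<mu> = 0")
    case True
    have "1 + 2 * T * c\<^sup>2 > (\<bar>c\<bar> / e)\<^sup>2"
    proof -
      have "(\<bar>c\<bar> / e)\<^sup>2 = c\<^sup>2 / e\<^sup>2" "2 * T * c\<^sup>2 = 2 * (c\<^sup>2 / e\<^sup>2)" "0 \<le> c\<^sup>2 / e\<^sup>2"
        by (simp_all add: True T_def power_divide)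
      then show ?thesis
        by linarith
    qed
    then have "\<bar>c\<bar> / e < sqrt (- (z \<bullet>\<^sub>M z))"
      by (intro real_less_rsqrt) (simp add: zz True mult.commute mult.left_commute)
    then have "\<bar>c\<bar> / sqrt (- (z \<bullet>\<^sub>M z)) < e"
      using assms(4) zz_neg by (simp add: field_simps)
    then show ?thesis
      using zz_neg by (simp add: y_def mink_simps zm True abs_mult divide_inverse mult.commute)
  next
    case False
    then have "z \<bullet>\<^sub>M m = 0"
      by (simp add: zm T_def)
    then show ?thesis
      using assms(4) by (simp add: y_def mink_simps)
  qed
  ultimately show ?thesis
    by (auto simp: hyp_plane_def)
qed

text \<open>
  On the plane orthogonal to \<open>n\<close>, the product with \<open>n'\<close> equals the product with
  \<open>m = n' - \<nu> n\<close>, where \<open>\<nu> = n \<bullet>\<^sub>M n'\<close>; this vector is orthogonal to \<open>n\<close> and has square \<open>1 - \<nu>\<^sup>2\<close>.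
\<close>
lemma plane_plane_distance:
  assumes "n \<bullet>\<^sub>M n = 1" "n' \<bullet>\<^sub>M n' = 1"
  shows "hyp_setdist (hyp_plane n) (hyp_plane n') =
    (if \<bar>n \<bullet>\<^sub>M n'\<bar> \<ge> 1 then arcosh \<bar>n \<bullet>\<^sub>M n'\<bar> else 0)"
proof -
  define \<nu> where "\<nu> = n \<bullet>\<^sub>M n'"
  define m where "m = n' - \<nu> *\<^sub>R n"
  have mn: "m \<bullet>\<^sub>M n = 0"
    by (simp add: m_def mink_simps assms \<nu>_def mink_commute)
  have mm: "m \<bullet>\<^sub>M m = 1 - \<nu>\<^sup>2"
    by (simp add: m_def mink_simps assms mink_commute[of n' n] power2_eq_square flip: \<nu>_def)
  have ym: "y \<bullet>\<^sub>M n' = y \<bullet>\<^sub>M m" if "y \<in> hyp_plane n" for y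
    using that by (simp add: m_def mink_simps hyp_plane_def)
  have sub: "hyp_plane n \<subseteq> hyp3"
    by (auto simp: hyp_plane_def)
  show ?thesis
  proof (cases "\<bar>\<nu>\<bar> > 1")
    case True
    then have neg: "m \<bullet>\<^sub>M m < 0"
      using one_less_power[of "\<bar>\<nu>\<bar>" 2] by (simp add: mm)
    have "hyp_setdist (hyp_plane n) (hyp_plane n') = arsinh (sqrt (\<bar>\<nu>\<bar>\<^sup>2 - 1))"
    proof (rule hyp_setdist_planeI[OF sub assms(2)])
      fix y assume y: "y \<in> hyp_plane n"
      then have "0 \<le> m \<bullet>\<^sub>M m + (m \<bullet>\<^sub>M y)\<^sup>2"
        by (intro reverse_cauchy_schwarz subsetD[OF sub])
      then have "\<bar>\<nu>\<bar>\<^sup>2 - 1 \<le> (y \<bullet>\<^sub>M n')\<^sup>2"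
        by (simp add: ym[OF y] mm mink_commute[of m y])
      then show "sqrt (\<bar>\<nu>\<bar>\<^sup>2 - 1) \<le> \<bar>y \<bullet>\<^sub>M n'\<bar>"
        using real_sqrt_le_mono[of "\<bar>\<nu>\<bar>\<^sup>2 - 1" "(y \<bullet>\<^sub>M n')\<^sup>2"] by simp
    next
      fix e :: real assume "e > 0"
      moreover obtain y where y: "y \<in> hyp_plane n" "\<bar>y \<bullet>\<^sub>M m\<bar> = sqrt (\<bar>\<nu>\<bar>\<^sup>2 - 1)"
        using plane_mink_attained[OF assms(1) mn neg] by (auto simp: mm)
      ultimately show "\<exists>y\<in>hyp_plane n. \<bar>y \<bullet>\<^sub>M n'\<bar> < sqrt (\<bar>\<nu>\<bar>\<^sup>2 - 1) + e"
        by (intro bexI[OF _ y(1)]) (simp add: ym y)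
    qed
    also have "\<dots> = arcosh \<bar>\<nu>\<bar>"
      using True by (metis sinh_arcosh_real arsinh_sinh_real less_imp_le)
    finally show ?thesis
      using True by (simp flip: \<nu>_def)
  next
    case False
    then have "m \<bullet>\<^sub>M m \<ge> 0"
      unfolding mm by (simp add: abs_square_le_1)
    then have "\<exists>y\<in>hyp_plane n. \<bar>y \<bullet>\<^sub>M n'\<bar> < 0 + e" if "e > 0" for e
      using plane_mink_small[OF assms(1) mn _ that] ym by auto
    then have "hyp_setdist (hyp_plane n) (hyp_plane n') = arsinh 0"
      by (intro hyp_setdist_planeI[OF sub assms(2)]) auto
    moreover have "arcosh \<bar>\<nu>\<bar> = 0" if "\<bar>\<nu>\<bar> \<ge> 1"
    proof -
      have "\<bar>\<nu>\<bar> = 1" using that False by simp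
      then show ?thesis by simp
    qed
    ultimately show ?thesis
      by (simp flip: \<nu>_def)
  qed
qed

section \<open>The distance formulas\<close>

theorem mainTheorem2:
  fixes x x' x\<^sub>0 x\<^sub>1 x\<^sub>0' x\<^sub>1' n n' :: "real ^ 4"
  assumes "x \<in> hyp3" "x' \<in> hyp3"
    and "x\<^sub>0 \<in> light_cone" "x\<^sub>1 \<in> light_cone" "x\<^sub>0 \<noteq> x\<^sub>1" "independent {x\<^sub>0, x\<^sub>1}"
    and "x\<^sub>0' \<in> light_cone" "x\<^sub>1' \<in> light_cone" "x\<^sub>0' \<noteq> x\<^sub>1'" "independent {x\<^sub>0', x\<^sub>1'}"
    and "n \<bullet>\<^sub>M n = 1" "n' \<bullet>\<^sub>M n' = 1"
  shows "hyp_dist x x' = arcosh (- (x \<bullet>\<^sub>M x')) \<and>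
      hyp_dist x x' = arcosh (((x' - x) \<bullet>\<^sub>M (x' - x)) / 2 + 1) \<and>
      hyp_setdist {x} (hyp_line x\<^sub>0 x\<^sub>1) =
        arcosh (sqrt (- 2 * (((x\<^sub>0 \<bullet>\<^sub>M x) * (x \<bullet>\<^sub>M x\<^sub>1)) / (x\<^sub>0 \<bullet>\<^sub>M x\<^sub>1)))) \<and>
      (let l = sqrt (((x\<^sub>0 \<bullet>\<^sub>M x\<^sub>0') * (x\<^sub>1 \<bullet>\<^sub>M x\<^sub>1')) / ((x\<^sub>0 \<bullet>\<^sub>M x\<^sub>1) * (x\<^sub>0' \<bullet>\<^sub>M x\<^sub>1')))
             + sqrt (((x\<^sub>0 \<bullet>\<^sub>M x\<^sub>1') * (x\<^sub>1 \<bullet>\<^sub>M x\<^sub>0')) / ((x\<^sub>0 \<bullet>\<^sub>M x\<^sub>1) * (x\<^sub>0' \<bullet>\<^sub>M x\<^sub>1')))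
       in hyp_setdist (hyp_line x\<^sub>0 x\<^sub>1) (hyp_line x\<^sub>0' x\<^sub>1') = 2 * arsinh (sqrt ((l - 1) / 2))) \<and>
      hyp_setdist {x} (hyp_plane n) = \<bar>arsinh (x \<bullet>\<^sub>M n)\<bar> \<and>
      hyp_setdist (hyp_line x\<^sub>0 x\<^sub>1) (hyp_plane n) =
        (if (x\<^sub>0 \<bullet>\<^sub>M n) * (n \<bullet>\<^sub>M x\<^sub>1) > 0
         then arsinh (sqrt (- 2 * (((x\<^sub>0 \<bullet>\<^sub>M n) * (n \<bullet>\<^sub>M x\<^sub>1)) / (x\<^sub>0 \<bullet>\<^sub>M x\<^sub>1)))) else 0) \<and>
      hyp_setdist (hyp_plane n) (hyp_plane n') =
        (if \<bar>n \<bullet>\<^sub>M n'\<bar> \<ge> 1 then arcosh \<bar>n \<bullet>\<^sub>M n'\<bar> else 0)"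
proof (intro conjI)
  show "hyp_dist x x' = arcosh (- (x \<bullet>\<^sub>M x'))"
    by (rule hyp_dist_eq_arcosh[OF assms(1,2)])
  moreover have "((x' - x) \<bullet>\<^sub>M (x' - x)) / 2 + 1 = - (x \<bullet>\<^sub>M x')"
    using assms(1,2) by (simp add: hyp3_def mink_simps mink_commute[of x' x] field_simps)
  ultimately show "hyp_dist x x' = arcosh (((x' - x) \<bullet>\<^sub>M (x' - x)) / 2 + 1)"
    by simp
  note line = assms(3,4) light_cone_mink_neg[OF assms(3-6)]
  note line' = assms(7,8) light_cone_mink_neg[OF assms(7-10)]
  show "hyp_setdist {x} (hyp_line x\<^sub>0 x\<^sub>1) =
      arcosh (sqrt (- 2 * (((x\<^sub>0 \<bullet>\<^sub>M x) * (x \<bullet>\<^sub>M x\<^sub>1)) / (x\<^sub>0 \<bullet>\<^sub>M x\<^sub>1))))"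
    by (rule point_line_distance[OF assms(1) line])
  show "let l = sqrt (((x\<^sub>0 \<bullet>\<^sub>M x\<^sub>0') * (x\<^sub>1 \<bullet>\<^sub>M x\<^sub>1')) / ((x\<^sub>0 \<bullet>\<^sub>M x\<^sub>1) * (x\<^sub>0' \<bullet>\<^sub>M x\<^sub>1')))
             + sqrt (((x\<^sub>0 \<bullet>\<^sub>M x\<^sub>1') * (x\<^sub>1 \<bullet>\<^sub>M x\<^sub>0')) / ((x\<^sub>0 \<bullet>\<^sub>M x\<^sub>1) * (x\<^sub>0' \<bullet>\<^sub>M x\<^sub>1')))
       in hyp_setdist (hyp_line x\<^sub>0 x\<^sub>1) (hyp_line x\<^sub>0' x\<^sub>1') = 2 * arsinh (sqrt ((l - 1) / 2))"
    unfolding Let_def by (rule line_line_distance[OF line line'])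
  show "hyp_setdist {x} (hyp_plane n) = \<bar>arsinh (x \<bullet>\<^sub>M n)\<bar>"
    by (rule point_plane_distance[OF assms(1,11)])
  show "hyp_setdist (hyp_line x\<^sub>0 x\<^sub>1) (hyp_plane n) =
        (if (x\<^sub>0 \<bullet>\<^sub>M n) * (n \<bullet>\<^sub>M x\<^sub>1) > 0
         then arsinh (sqrt (- 2 * (((x\<^sub>0 \<bullet>\<^sub>M n) * (n \<bullet>\<^sub>M x\<^sub>1)) / (x\<^sub>0 \<bullet>\<^sub>M x\<^sub>1)))) else 0)"
    by (rule line_plane_distance[OF line assms(11)])
  show "hyp_setdist (hyp_plane n) (hyp_plane n') =
        (if \<bar>n \<bullet>\<^sub>M n'\<bar> \<ge> 1 then arcosh \<bar>n \<bullet>\<^sub>M n'\<bar> else 0)"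
    by (rule plane_plane_distance[OF assms(11,12)])
qed

end
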